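(* Let $L>0$ and let $\mathcal{I}=\{(x_i,f_i,\xi_i)\}_{i\in[N]}$ with $(x_i,f_i,\xi_i)\in\operatorname{ri}(\Delta_d)\times\mathbb{R}\times\Theta_d$. Put $r_i:=f_i-\langle\xi_i,x_i\rangle$ and $w_i:=\exp\big(L^{-1}(r_i\mathsf{1}_d+\xi_i)\big)$. The existence of $f\in\mathsf{Ent}_d(L)$ that satisfies $f(x_i)=f_i$ and $\nabla f(x_i)=\xi_i$ for all $i\in[N]$ is equivalent to the inequalities $$\langle x_i,w_j/w_i\rangle\le1\qquad\text{for all } i,j\in[N].$$
   Context: $\Delta_d=\{x\in\mathbb{R}^d: x\ge 0,\ \sum_k (x)_k=1\}$, $\operatorname{ri}(\Delta_d)$ is its relative interior (all entries positive), $\mathsf{1}_d$ the all-ones vector, $\Theta_d:=\operatorname{span}\{\mathsf{1}_d\}^\perp$, $[N]=\{1,\dots,N\}$. The operations $\exp(\cdot)$ and division of vectors are entrywise. For $f:\Delta_d\to\mathbb{R}$ differentiable on $\operatorname{ri}(\Delta_d)$ (within the affine hull of $\Delta_d$), $\nabla f(x)\in\Theta_d$ denotes the tangent gradient, i.e. the unique vector of $\Theta_d$ representing the differential of $f$ along directions in $\Theta_d$. The Kullback--Leibler divergence is $D_h(x,u):=\sum_{k\in\operatorname{supp}x}(x)_k\log\frac{(x)_k}{(u)_k}$ if $\operatorname{supp}x\subseteq\operatorname{supp}u$, and $+\infty$ otherwise. The class $\mathsf{Ent}_d(L)$ consists of all functions $f:\Delta_d\to\mathbb{R}$ that are convex,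 continuously differentiable on $\operatorname{ri}(\Delta_d)$, and satisfy $0\le f(x)-f(u)-\langle\nabla f(u),x-u\rangle\le L\,D_h(x,u)$ for all $(x,u)\in\Delta_d\times\operatorname{ri}(\Delta_d)$. *)

theory Defs
  imports "HOL-Analysis.Analysis"
begin

definition prob_simplex :: "(real ^ 'n) set"  (\<open>\<Delta>\<close>)
  where "\<Delta> = {x. (\<forall>k. 0 \<le> x $ k) \<and> (\<Sum>k\<in>UNIV. x $ k) = 1}"

definition tangent_space :: "(real ^ 'n) set"  (\<open>\<Theta>\<close>)
  where "\<Theta> = (span {1})\<^sup>\<bottom>"

definition vec_exp :: "real ^ 'n \<Rightarrow> real ^ 'n"
  where "vec_exp v = (\<chi> k. exp (v $ k))"

definition vec_div :: "real ^ 'n \<Rightarrow> real ^ 'n \<Rightarrow> real ^ 'n"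
  where "vec_div v w = (\<chi> k. v $ k / w $ k)"

definition supp :: "real ^ 'n \<Rightarrow> 'n set"
  where "supp x = {k. x $ k \<noteq> 0}"

definition KL :: "real ^ 'n \<Rightarrow> real ^ 'n \<Rightarrow> ereal"
  where "KL x u = (if supp x \<subseteq> supp u
                   then ereal (\<Sum>k\<in>supp x. x $ k * ln (x $ k / u $ k)) else \<infinity>)"

text \<open>
  Functions on the simplex are represented by functions on the whole space whose values off the
  simplex are irrelevant. In particular, a derivative within the affine hull at a point of the
  relative interior only sees values on the simplex.
\<close>

definition has_tangent_gradient :: "(real ^ 'n \<Rightarrow> real) \<Rightarrow> real ^ 'n \<Rightarrow> real ^ 'n \<Rightarrow> bool"
  where "has_tangent_gradient f g u \<longleftrightarrow>
    g \<in> \<Theta> \<and> (f has_derivative (\<lambda>v. g \<bullet> v)) (at u within affine hull \<Delta>)"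

definition tangent_gradient :: "(real ^ 'n \<Rightarrow> real) \<Rightarrow> real ^ 'n \<Rightarrow> real ^ 'n"  (\<open>\<nabla>\<close>)
  where "\<nabla> f u = (THE g. has_tangent_gradient f g u)"

definition Ent :: "real \<Rightarrow> (real ^ 'n \<Rightarrow> real) set"
  where "Ent L = {f. convex_on \<Delta> f
     \<and> (\<forall>u\<in>rel_interior \<Delta>. f differentiable (at u within affine hull \<Delta>))
     \<and> continuous_on (rel_interior \<Delta>) (\<nabla> f)
     \<and> (\<forall>x\<in>\<Delta>. \<forall>u\<in>rel_interior \<Delta>.
          0 \<le> f x - f u - \<nabla> f u \<bullet> (x - u) \<and>
          ereal (f x - f u - \<nabla> f u \<bullet> (x - u)) \<le> ereal L * KL x u)}"

lemma mem_tangent_space: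
  fixes v :: "real ^ 'n"
  shows "v \<in> \<Theta> \<longleftrightarrow> (\<Sum>k\<in>UNIV. v $ k) = 0"
proof -
  have eq: "(1 :: real ^ 'n) \<bullet> v = (\<Sum>k\<in>UNIV. v $ k)"
    by (simp add: inner_vec_def)
  show ?thesis
    unfolding tangent_space_def orthogonal_comp_def orthogonal_def span_singleton
    by (auto simp flip: eq)
qed

lemma rel_interior_prob_simplex:
  "rel_interior \<Delta> = {x :: real ^ 'n. (\<forall>k. 0 < x $ k) \<and> (\<Sum>k\<in>UNIV. x $ k) = 1}"
proof -
  have ax: "axis k 1 \<in> (\<Delta> :: (real ^ 'n) set)" for k :: 'n
    by (simp add: prob_simplex_def axis_def)
  have cv: "convex (\<Delta> :: (real ^ 'n) set)"
    unfolding convex_def prob_simplex_def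
    by (auto simp: sum.distrib simp flip: sum_distrib_left)
  have ne: "(\<Delta> :: (real ^ 'n) set) \<noteq> {}" using ax by auto
  show ?thesis
  proof (intro set_eqI iffI)
    fix x :: "real ^ 'n" assume x: "x \<in> rel_interior \<Delta>"
    then have xD: "x \<in> \<Delta>" using rel_interior_subset by auto
    have "x $ k \<noteq> 0" for k
    proof
      assume 0: "x $ k = 0"
      obtain e where e: "e > 1" "(1 - e) *\<^sub>R axis k 1 + e *\<^sub>R x \<in> \<Delta>"
        using x ax[of k] convex_rel_interior_iff[OF cv ne] by blast
      then have "0 \<le> ((1 - e) *\<^sub>R axis k 1 + e *\<^sub>R x) $ k"
        unfolding prob_simplex_def by blast
      then show False using e 0 by (simp add: axis_def)
    qed
    then show "x \<in> {x. (\<forall>k. 0 < x $ k) \<and> (\<Sum>k\<in>UNIV. x $ k) = 1}"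
      using xD by (auto simp: prob_simplex_def less_le)
  next
    fix x :: "real ^ 'n"
    assume "x \<in> {x. (\<forall>k. 0 < x $ k) \<and> (\<Sum>k\<in>UNIV. x $ k) = 1}"
    then have pos: "\<And>k. 0 < x $ k" and s1: "(\<Sum>k\<in>UNIV. x $ k) = 1" by auto
    define d where "d = Min (range (($) x))"
    have d: "d > 0" "\<And>k. d \<le> x $ k" using pos by (auto simp: d_def)
    have "(1 - (1 + d)) *\<^sub>R z + (1 + d) *\<^sub>R x \<in> \<Delta>" if z: "z \<in> \<Delta>" for z
    proof -
      have zs: "(\<Sum>k\<in>UNIV. z $ k) = 1" and zp: "\<And>k. 0 \<le> z $ k"
        using z by (auto simp: prob_simplex_def)
      have z1: "z $ k \<le> 1" for k
        using member_le_sum[of k UNIV "($) z"] zs zp by simp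
      have "0 \<le> (1 - (1 + d)) * z $ k + (1 + d) * x $ k" for k
      proof -
        have "d * z $ k \<le> d * 1"
          using d z1[of k] by (intro mult_left_mono) auto
        moreover have "0 \<le> d * x $ k" using d pos[of k] by simp
        moreover have "(1 - (1 + d)) * z $ k + (1 + d) * x $ k = x $ k - d * z $ k + d * x $ k"
          by (simp add: algebra_simps)
        ultimately show ?thesis using d(2)[of k] by linarith
      qed
      then show ?thesis
        using zs s1 by (simp add: prob_simplex_def sum.distrib sum_subtractf flip: sum_distrib_left)
    qed
    then show "x \<in> rel_interior \<Delta>"
      using d convex_rel_interior_iff[OF cv ne] by (metis less_add_same_cancel1)
  qed
qed

lemma affine_hull_prob_simplex:
  "affine hull \<Delta> = {x :: real ^ 'n. (\<Sum>k\<in>UNIV. x $ k) = 1}"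
proof (intro set_eqI iffI)
  fix x :: "real ^ 'n" assume x: "x \<in> affine hull \<Delta>"
  have "affine {x :: real ^ 'n. (\<Sum>k\<in>UNIV. x $ k) = 1}"
    by (auto simp: affine_def sum.distrib simp flip: sum_distrib_left)
  then have "affine hull (\<Delta> :: (real ^ 'n) set) \<subseteq> {x. (\<Sum>k\<in>UNIV. x $ k) = 1}"
    by (intro hull_minimal) (auto simp: prob_simplex_def)
  with x show "x \<in> {x. (\<Sum>k\<in>UNIV. x $ k) = 1}" by blast
next
  fix x :: "real ^ 'n" assume "x \<in> {x. (\<Sum>k\<in>UNIV. x $ k) = 1}"
  then have s: "(\<Sum>k\<in>UNIV. x $ k) = 1" by simp
  let ?S = "range (\<lambda>k::'n. axis k (1::real))"
  have inj: "inj (\<lambda>k::'n. axis k (1::real))" by (auto simp: inj_on_def axis_eq_axis)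
  have val: "x \<bullet> axis k 1 = x $ k" for k by (simp add: inner_axis)
  have "sum (\<lambda>v. x \<bullet> v) ?S = 1"
    using s by (simp add: sum.reindex[OF inj] val)
  moreover have "sum (\<lambda>v. (x \<bullet> v) *\<^sub>R v) ?S = x"
    unfolding sum.reindex[OF inj] o_def val
    by (simp add: vec_eq_iff axis_def if_distrib cong: if_cong)
  ultimately have "x \<in> affine hull ?S" by (subst affine_hull_finite) auto
  moreover have "?S \<subseteq> \<Delta>" by (auto simp: prob_simplex_def axis_def)
  ultimately show "x \<in> affine hull \<Delta>" using hull_mono by blast
qed

lemma has_tangent_gradient_unique:
  assumes u: "u \<in> rel_interior \<Delta>"
    and g: "has_tangent_gradient f g u" and h: "has_tangent_gradient f h u"
  shows "g = h"
proof -
  define v where "v = g - h"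
  have v: "(\<Sum>k\<in>UNIV. v $ k) = 0"
    using g h by (simp add: v_def has_tangent_gradient_def mem_tangent_space sum_subtractf)
  have u1: "(\<Sum>k\<in>UNIV. u $ k) = 1" using u by (simp add: rel_interior_prob_simplex)
  let ?c = "\<lambda>t::real. u + t *\<^sub>R v"
  have c: "?c ` UNIV \<subseteq> affine hull \<Delta>"
    using u1 v by (auto simp: affine_hull_prob_simplex sum.distrib simp flip: sum_distrib_left)
  have dc: "(?c has_derivative (\<lambda>t. t *\<^sub>R v)) (at 0)"
    by (auto intro!: derivative_eq_intros)
  have "((\<lambda>x. f x - f x) has_derivative (\<lambda>w. g \<bullet> w - h \<bullet> w)) (at u within affine hull \<Delta>)"
    using g h by (intro has_derivative_diff) (auto simp: has_tangent_gradient_def)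
  then have "((\<lambda>x. 0) has_derivative (\<lambda>w. v \<bullet> w)) (at (?c 0) within ?c ` UNIV)"
    using c by (auto simp: v_def inner_diff_left intro: has_derivative_subset)
  from diff_chain_within[OF dc this]
  have "((\<lambda>t::real. 0) has_derivative (\<lambda>t. v \<bullet> (t *\<^sub>R v))) (at 0)" by (simp add: o_def)
  from has_derivative_unique[OF this has_derivative_const]
  have "v \<bullet> (1 *\<^sub>R v) = 0" by meson
  then show ?thesis by (simp add: v_def)
qed

lemma tangent_gradient_eqI:
  assumes "u \<in> rel_interior \<Delta>" "has_tangent_gradient f g u"
  shows "\<nabla> f u = g"
  unfolding tangent_gradient_def
  using assms has_tangent_gradient_unique by blast

lemma has_tangent_gradient_tangent_gradient:
  fixes f :: "real ^ 'n \<Rightarrow> real"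
  assumes u: "u \<in> rel_interior \<Delta>" and f: "f differentiable (at u within affine hull \<Delta>)"
  shows "has_tangent_gradient f (\<nabla> f u) u"
proof -
  obtain D where D: "(f has_derivative D) (at u within affine hull \<Delta>)"
    using f by (auto simp: differentiable_def)
  then interpret D: linear D by (rule has_derivative_linear)
  define c :: "real ^ 'n" where "c = (\<chi> k. D (axis k 1))"
  define m where "m = (\<Sum>k\<in>UNIV. c $ k) / real CARD('n)"
  define g where "g = c - m *\<^sub>R 1"
  have Dc: "D v = c \<bullet> v" for v
  proof -
    have "D v = D (\<Sum>k\<in>UNIV. v $ k *\<^sub>R axis k 1)"
      by (rule arg_cong[of _ _ D])
        (simp add: vec_eq_iff axis_def if_distrib cong: if_cong)
    also have "\<dots> = c \<bullet> v"
      by (simp add: D.sum D.scale c_def inner_vec_def mult.commute)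
    finally show ?thesis .
  qed
  have gT: "g \<in> \<Theta>"
    by (simp add: mem_tangent_space g_def m_def sum_subtractf)
  have gv: "g \<bullet> (y - u) = D (y - u)" if "y \<in> affine hull \<Delta>" for y
  proof -
    have "1 \<bullet> (y - u) = 0"
      using that u by (simp add: affine_hull_prob_simplex rel_interior_prob_simplex
          inner_vec_def sum_subtractf)
    then show ?thesis by (simp add: Dc g_def inner_diff_left)
  qed
  have "(f has_derivative (\<lambda>v. g \<bullet> v)) (at u within affine hull \<Delta>)"
    unfolding has_derivative_within'
  proof (intro conjI allI impI)
    show "bounded_linear (\<lambda>v. g \<bullet> v)" by (rule bounded_linear_inner_right)
    fix e :: real assume "0 < e"
    then show "\<exists>d>0. \<forall>x'\<in>affine hull \<Delta>. 0 < norm (x' - u) \<and> norm (x' - u) < d \<longrightarrow>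
        norm (f x' - f u - g \<bullet> (x' - u)) / norm (x' - u) < e"
      using D unfolding has_derivative_within' by (simp add: gv cong: ball_cong)
  qed
  with gT have "has_tangent_gradient f g u" by (simp add: has_tangent_gradient_def)
  with tangent_gradient_eqI[OF u this] show ?thesis by simp
qed

end

theory Submission
  imports Defs
begin

text \<open>
  On the simplex an affine function \<open>x \<mapsto> r + \<langle>\<xi>, x\<rangle>\<close> is the linear function \<open>x \<mapsto> L \<langle>x, ln w\<rangle>\<close> with
  \<open>w = exp ((r 1 + \<xi>) / L)\<close>, because the entries of \<open>x\<close> sum to one. So the prescribed tangents are
  encoded by the positive vectors \<open>w\<^sub>i\<close>, and the idea is to look for the interpolant in the form
  \<open>f x = L max {\<langle>x, ln w\<rangle> | w \<in> W}\<close>, with \<open>W\<close> the convex hull of the \<open>w\<^sub>i\<close>. Convexifying in the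
  variable \<open>w\<close>, rather than in \<open>ln w\<close>, is what produces the upper bound by the divergence.

  For \<open>u \<ge> 0\<close> the function \<open>w \<mapsto> \<langle>u, ln w\<rangle>\<close> is concave with gradient \<open>u / w\<close>, so \<open>a \<in> W\<close> maximizes it
  over \<open>W\<close> for a point \<open>u\<close> of the simplex precisely when \<open>\<langle>u, b / a\<rangle> \<le> 1\<close> for all \<open>b \<in> W\<close>. This
  condition is affine in \<open>b\<close>, hence it suffices to have it at the \<open>w\<^sub>j\<close>: the inequalities of the
  theorem say that \<open>w\<^sub>i\<close> is a maximizer at \<open>x\<^sub>i\<close>. Then \<open>f\<close> takes the value \<open>L \<langle>x\<^sub>i, ln w\<^sub>i\<rangle>\<close>, which is
  the prescribed one, and its tangent gradient is the projection of \<open>L ln w\<^sub>i\<close>, which is \<open>\<xi>\<^sub>i\<close>.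

  Membership in the class rests on the same condition. If \<open>a\<close> is a maximizer at \<open>u\<close> and \<open>b\<close> one at \<open>x\<close>,
  then the linearization error of \<open>f\<close> at \<open>u\<close> is \<open>L \<langle>x, ln (b / a)\<rangle> \<ge> 0\<close>, and \<open>ln s \<le> s - 1\<close> together with
  \<open>\<langle>u, b / a\<rangle> \<le> 1\<close> bounds it by \<open>L\<close> times the divergence of \<open>x\<close> from \<open>u\<close>
  (\<open>inner_vec_ln_diff_le_KL\<close>). The divergence is quadratically small near \<open>u\<close> (\<open>KL_le_quadratic\<close>),
  which gives differentiability; adding the conditions at two points shows that the maximizer, and
  with it the gradient, varies continuously (\<open>maximizer_stability\<close>).

  Conversely, for \<open>f\<close> in the class the tangent at \<open>v\<close> lies below the upper model
  at \<open>u\<close>, that is, the tangent at \<open>u\<close> plus \<open>L\<close> times the divergence from \<open>u\<close>. Evaluating this at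
  the point \<open>z\<close> where the comparison is tightest, a multiple of the entrywise product of \<open>u\<close> with
  \<open>b / a\<close>, yields \<open>ln \<langle>u, b / a\<rangle> \<le> 0\<close>
  (\<open>Ent_imp_inner_vec_div_le_one\<close>).
\<close>

section \<open>Logarithms and the tangent space\<close>

definition vec_ln :: "real ^ 'n \<Rightarrow> real ^ 'n"
  where "vec_ln v = (\<chi> k. ln (v $ k))"

definition tangent_proj :: "real ^ 'n \<Rightarrow> real ^ 'n"
  where "tangent_proj v = v - ((\<Sum>k\<in>UNIV. v $ k) / real CARD('n)) *\<^sub>R 1"

lemma tangent_proj_in: "tangent_proj v \<in> \<Theta>"
  by (simp add: mem_tangent_space tangent_proj_def sum_subtractf)

lemma tangent_proj_add_one:
  assumes "\<xi> \<in> \<Theta>"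
  shows "tangent_proj (c *\<^sub>R 1 + \<xi>) = \<xi>"
  using assms by (simp add: mem_tangent_space tangent_proj_def sum.distrib vec_eq_iff)

lemma one_inner_prob_simplex: "x \<in> \<Delta> \<Longrightarrow> 1 \<bullet> x = 1"
  by (simp add: prob_simplex_def inner_vec_def)

lemma tangent_proj_inner_diff:
  assumes "x \<in> \<Delta>" "u \<in> \<Delta>"
  shows "tangent_proj v \<bullet> (x - u) = v \<bullet> (x - u)"
  using one_inner_prob_simplex[OF assms(1)] one_inner_prob_simplex[OF assms(2)]
  by (simp add: tangent_proj_def inner_diff)

lemma rel_interior_prob_simplexD:
  assumes "u \<in> rel_interior \<Delta>"
  shows "u \<in> \<Delta>" "0 < u $ k" "supp u = UNIV"
proof -
  have u: "\<And>k. 0 < u $ k" "(\<Sum>k\<in>UNIV. u $ k) = 1"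
    using assms by (simp_all add: rel_interior_prob_simplex)
  then show "u \<in> \<Delta>" "0 < u $ k" "supp u = UNIV"
    by (auto simp: prob_simplex_def supp_def less_imp_le less_imp_neq[THEN not_sym])
qed

section \<open>Estimates for the Kullback--Leibler divergence\<close>

lemma KL_rel_interior:
  assumes "u \<in> rel_interior \<Delta>"
  shows "KL x u = ereal (\<Sum>k\<in>supp x. x $ k * ln (x $ k / u $ k))"
  using rel_interior_prob_simplexD(3)[OF assms] by (simp add: KL_def)

lemma sum_supp:
  fixes x :: "real ^ 'n"
  shows "(\<Sum>k\<in>supp x. x $ k * c k) = (\<Sum>k\<in>UNIV. x $ k * c k)"
  by (rule sum.mono_neutral_left) (auto simp: supp_def)

text \<open>
  Entrywise, \<open>x ln (b / a) - x ln (x / u) = x ln (u b / (x a)) \<le> u b / a - x\<close> by \<open>ln s \<le> s - 1\<close>; the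
  right-hand sides add up to at most \<open>\<langle>u, b / a\<rangle> - 1\<close>. The case \<open>x = u\<close>, where the divergence
  vanishes, says that the first-order condition is sufficient for a maximum.
\<close>

lemma inner_vec_ln_diff_le_KL:
  fixes x u a b :: "real ^ 'n"
  assumes x: "x \<in> \<Delta>" and u: "u \<in> rel_interior \<Delta>"
    and a: "\<And>k. 0 < a $ k" and b: "\<And>k. 0 < b $ k"
    and opt: "u \<bullet> vec_div b a \<le> 1"
  shows "x \<bullet> vec_ln b - x \<bullet> vec_ln a \<le> (\<Sum>k\<in>supp x. x $ k * ln (x $ k / u $ k))"
proof -
  note u0 = rel_interior_prob_simplexD(2)[OF u]
  have xs: "(\<Sum>k\<in>UNIV. x $ k) = 1" and x0: "\<And>k. 0 \<le> x $ k"
    using x by (auto simp: prob_simplex_def)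
  have "x $ k * (ln (b $ k) - ln (a $ k)) - x $ k * ln (x $ k / u $ k)
      \<le> u $ k * (b $ k / a $ k) - x $ k" if k: "k \<in> supp x" for k
  proof -
    have xk: "0 < x $ k" using k x0[of k] by (auto simp: supp_def less_le)
    have "x $ k * (ln (b $ k) - ln (a $ k)) - x $ k * ln (x $ k / u $ k)
        = x $ k * ln (u $ k * b $ k / (x $ k * a $ k))"
      using xk u0[of k] a[of k] b[of k] by (simp add: ln_mult ln_div algebra_simps)
    also have "\<dots> \<le> x $ k * (u $ k * b $ k / (x $ k * a $ k) - 1)"
      using xk u0[of k] a[of k] b[of k] by (intro mult_left_mono ln_le_minus_one) auto
    also have "\<dots> = u $ k * (b $ k / a $ k) - x $ k"
      using xk a[of k] by (simp add: field_simps)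
    finally show ?thesis .
  qed
  then have "(\<Sum>k\<in>supp x. x $ k * (ln (b $ k) - ln (a $ k)) - x $ k * ln (x $ k / u $ k))
      \<le> (\<Sum>k\<in>supp x. u $ k * (b $ k / a $ k) - x $ k)"
    by (rule sum_mono)
  also have "\<dots> \<le> (\<Sum>k\<in>UNIV. u $ k * (b $ k / a $ k)) - 1"
  proof -
    have "(\<Sum>k\<in>supp x. u $ k * (b $ k / a $ k)) \<le> (\<Sum>k\<in>UNIV. u $ k * (b $ k / a $ k))"
      using u0 a b by (intro sum_mono2) (auto intro!: mult_nonneg_nonneg simp: less_imp_le)
    moreover have "(\<Sum>k\<in>supp x. x $ k) = 1"
      using sum_supp[of x "\<lambda>_. 1"] xs by simp
    ultimately show ?thesis by (simp add: sum_subtractf)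
  qed
  also have "\<dots> \<le> 0" using opt by (simp add: inner_vec_def vec_div_def)
  finally have "(\<Sum>k\<in>supp x. x $ k * (ln (b $ k) - ln (a $ k)))
      \<le> (\<Sum>k\<in>supp x. x $ k * ln (x $ k / u $ k))"
    by (simp add: sum_subtractf)
  then show ?thesis
    unfolding sum_supp by (simp add: inner_vec_def vec_ln_def sum_subtractf right_diff_distrib)
qed

text \<open>
  The divergence is at most the chi-squared divergence \<open>\<Sum> (x - u)\<^sup>2 / u\<close>, again by \<open>ln s \<le> s - 1\<close>.
\<close>

lemma KL_le_quadratic:
  fixes x u :: "real ^ 'n"
  assumes x: "x \<in> \<Delta>" and u: "u \<in> rel_interior \<Delta>"
  shows "(\<Sum>k\<in>supp x. x $ k * ln (x $ k / u $ k)) \<le> (\<Sum>k\<in>UNIV. 1 / u $ k) * (norm (x - u))\<^sup>2"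
proof -
  note u0 = rel_interior_prob_simplexD(2)[OF u]
  have xs: "(\<Sum>k\<in>UNIV. x $ k) = 1" and x0: "\<And>k. 0 \<le> x $ k"
    and us: "(\<Sum>k\<in>UNIV. u $ k) = 1"
    using x rel_interior_prob_simplexD(1)[OF u] by (auto simp: prob_simplex_def)
  have "x $ k * ln (x $ k / u $ k) \<le> x $ k * (x $ k / u $ k - 1)" for k
  proof (cases "x $ k = 0")
    case False
    then have "0 < x $ k" using x0[of k] by simp
    then show ?thesis using u0[of k] by (intro mult_left_mono ln_le_minus_one) auto
  qed simp
  then have "(\<Sum>k\<in>UNIV. x $ k * ln (x $ k / u $ k)) \<le> (\<Sum>k\<in>UNIV. x $ k * (x $ k / u $ k - 1))"
    by (rule sum_mono)
  also have "\<dots> = (\<Sum>k\<in>UNIV. 1 / u $ k * ((x - u) $ k)\<^sup>2 + (x $ k - u $ k))"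
  proof (rule sum.cong[OF refl])
    fix k show "x $ k * (x $ k / u $ k - 1) = 1 / u $ k * ((x - u) $ k)\<^sup>2 + (x $ k - u $ k)"
      using u0[of k] by (simp add: field_simps power2_eq_square)
  qed
  also have "\<dots> = (\<Sum>k\<in>UNIV. 1 / u $ k * ((x - u) $ k)\<^sup>2)"
    using xs us by (simp add: sum.distrib sum_subtractf)
  also have "\<dots> \<le> (\<Sum>k\<in>UNIV. 1 / u $ k * (norm (x - u))\<^sup>2)"
  proof (intro sum_mono mult_left_mono)
    fix k show "((x - u) $ k)\<^sup>2 \<le> (norm (x - u))\<^sup>2"
      using component_le_norm_cart[of "x - u" k] by (metis abs_ge_zero power2_abs power_mono)
  qed (use u0 in \<open>auto simp: less_imp_le\<close>)
  finally show ?thesis by (simp add: sum_supp sum_distrib_right)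
qed

text \<open>
  A bound on the simplex is enough: near a point of the relative interior the affine hull contains
  only points of the simplex.
\<close>

lemma has_tangent_gradientI_quadratic:
  assumes u: "u \<in> rel_interior \<Delta>" and g: "g \<in> \<Theta>"
    and bound: "\<And>x. x \<in> \<Delta> \<Longrightarrow> \<bar>f x - f u - g \<bullet> (x - u)\<bar> \<le> C * (norm (x - u))\<^sup>2"
  shows "has_tangent_gradient f g u"
  unfolding has_tangent_gradient_def has_derivative_within'
proof (intro conjI allI impI)
  show "g \<in> \<Theta>" by fact
  show "bounded_linear (\<lambda>v. g \<bullet> v)" by (rule bounded_linear_inner_right)
  fix e :: real assume e: "0 < e"
  obtain \<delta> where \<delta>: "0 < \<delta>" "ball u \<delta> \<inter> affine hull \<Delta> \<subseteq> \<Delta>"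
    using u by (auto simp: mem_rel_interior_ball)
  define d where "d = min \<delta> (e / (\<bar>C\<bar> + 1))"
  have "0 < d" using \<delta> e by (auto simp: d_def intro!: divide_pos_pos)
  moreover have "norm (f x - f u - g \<bullet> (x - u)) / norm (x - u) < e"
    if x: "x \<in> affine hull \<Delta>" "0 < norm (x - u)" "norm (x - u) < d" for x
  proof -
    have "x \<in> ball u \<delta>" using x(3) by (simp add: d_def dist_norm norm_minus_commute)
    then have "x \<in> \<Delta>" using \<delta>(2) x(1) by blast
    then have "norm (f x - f u - g \<bullet> (x - u)) \<le> C * (norm (x - u))\<^sup>2" using bound by simp
    also have "\<dots> \<le> ((\<bar>C\<bar> + 1) * norm (x - u)) * norm (x - u)"
      by (simp add: power2_eq_square mult_right_mono flip: mult.assoc)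
    also have "\<dots> < e * norm (x - u)"
      using x(2,3) by (intro mult_strict_right_mono) (auto simp: d_def field_simps)
    finally show ?thesis using x(2) by (simp add: field_simps)
  qed
  ultimately show "\<exists>d>0. \<forall>x'\<in>affine hull \<Delta>. 0 < norm (x' - u) \<and> norm (x' - u) < d \<longrightarrow>
      norm (f x' - f u - g \<bullet> (x' - u)) / norm (x' - u) < e" by blast
qed

section \<open>Maximal expected logarithm over a convex body\<close>

locale positive_convex_body =
  fixes W :: "(real ^ 'n) set"
  assumes compact_W: "compact W" and convex_W: "convex W" and nonempty_W: "W \<noteq> {}"
    and pos: "\<And>w k. w \<in> W \<Longrightarrow> 0 < w $ k"
begin

definition value_fun :: "real ^ 'n \<Rightarrow> real"
  where "value_fun x = (SUP w\<in>W. x \<bullet> vec_ln w)"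

definition maximizer :: "real ^ 'n \<Rightarrow> real ^ 'n \<Rightarrow> bool"
  where "maximizer x a \<longleftrightarrow> a \<in> W \<and> (\<forall>b\<in>W. x \<bullet> vec_ln b \<le> x \<bullet> vec_ln a)"

lemma maximizer_exists: "\<exists>a. maximizer x a"
proof -
  have "continuous_on W (\<lambda>w. x \<bullet> vec_ln w)"
    unfolding vec_ln_def inner_vec_def
    by (intro continuous_intros) (auto simp: pos less_imp_neq[THEN not_sym])
  from continuous_attains_sup[OF compact_W nonempty_W this] show ?thesis
    by (auto simp: maximizer_def)
qed

lemma value_fun_eq: "maximizer x a \<Longrightarrow> value_fun x = x \<bullet> vec_ln a"
  unfolding value_fun_def maximizer_def by (rule cSup_eq_maximum) auto

lemma value_fun_ge: "b \<in> W \<Longrightarrow> x \<bullet> vec_ln b \<le> value_fun x"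
  using maximizer_exists[of x] value_fun_eq by (auto simp: maximizer_def)

text \<open>
  If \<open>\<langle>u, b / a\<rangle> > 1\<close>, then \<open>w \<mapsto> \<langle>u, ln w\<rangle>\<close> has a positive derivative at \<open>a\<close> in the direction of \<open>b\<close>
  and increases along the segment from \<open>a\<close> to \<open>b\<close>, which stays in \<open>W\<close>.
\<close>

lemma maximizer_first_order:
  assumes a: "maximizer u a" and u: "u \<in> \<Delta>" and b: "b \<in> W"
  shows "u \<bullet> vec_div b a \<le> 1"
proof (rule ccontr)
  assume *: "\<not> u \<bullet> vec_div b a \<le> 1"
  have aW: "a \<in> W" using a by (simp add: maximizer_def)
  define \<psi> where "\<psi> t = (\<Sum>k\<in>UNIV. u $ k * ln (a $ k + t * (b $ k - a $ k)))" for t :: real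
  have \<psi>: "\<psi> t = u \<bullet> vec_ln (a + t *\<^sub>R (b - a))" for t
    by (simp add: \<psi>_def inner_vec_def vec_ln_def)
  have "(\<psi> has_real_derivative (\<Sum>k\<in>UNIV. u $ k * ((b $ k - a $ k) / a $ k))) (at 0)"
    unfolding \<psi>_def using pos[OF aW]
    by (auto intro!: derivative_eq_intros sum.cong)
  moreover have "(\<Sum>k\<in>UNIV. u $ k * ((b $ k - a $ k) / a $ k)) = u \<bullet> vec_div b a - 1"
  proof -
    have "(b $ k - a $ k) / a $ k = b $ k / a $ k - 1" for k
      using pos[OF aW, of k] by (simp add: field_simps)
    then show ?thesis using u
      by (simp add: inner_vec_def vec_div_def right_diff_distrib sum_subtractf prob_simplex_def)
  qed
  ultimately obtain d where d: "d > 0" "\<And>t. 0 < t \<Longrightarrow> t < d \<Longrightarrow> \<psi> 0 < \<psi> t"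
    using * DERIV_pos_inc_right[of \<psi> "u \<bullet> vec_div b a - 1" 0] by auto
  define t where "t = min 1 (d / 2)"
  have t: "0 < t" "t < d" "t \<le> 1" using d(1) by (auto simp: t_def)
  have "a + t *\<^sub>R (b - a) = (1 - t) *\<^sub>R a + t *\<^sub>R b" by (simp add: algebra_simps)
  then have "a + t *\<^sub>R (b - a) \<in> W"
    using convexD[OF convex_W aW b, of "1 - t" t] t by simp
  then have "\<psi> t \<le> \<psi> 0" using a by (simp add: \<psi> maximizer_def)
  with d(2)[OF t(1,2)] show False by simp
qed

lemma maximizerI:
  assumes u: "u \<in> rel_interior \<Delta>" and a: "a \<in> W"
    and opt: "\<And>b. b \<in> W \<Longrightarrow> u \<bullet> vec_div b a \<le> 1"
  shows "maximizer u a"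
proof -
  have "u \<bullet> vec_ln b \<le> u \<bullet> vec_ln a" if b: "b \<in> W" for b
    using inner_vec_ln_diff_le_KL[OF _ u pos[OF a] pos[OF b] opt[OF b], of u]
      rel_interior_prob_simplexD[OF u] by (simp add: less_imp_neq[THEN not_sym])
  then show ?thesis using a by (simp add: maximizer_def)
qed

text \<open>
  The linearization of \<open>value_fun\<close> at \<open>u\<close> is \<open>x \<mapsto> \<langle>x, ln a\<rangle>\<close>, so the error at \<open>x\<close> is
  \<open>\<langle>x, ln b\<rangle> - \<langle>x, ln a\<rangle>\<close> for any maximizer \<open>b\<close> at \<open>x\<close>.
\<close>

lemma value_fun_bounds:
  assumes x: "x \<in> \<Delta>" and u: "u \<in> rel_interior \<Delta>" and a: "maximizer u a"
  shows "0 \<le> value_fun x - value_fun u - vec_ln a \<bullet> (x - u)"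
    and "value_fun x - value_fun u - vec_ln a \<bullet> (x - u)
      \<le> (\<Sum>k\<in>supp x. x $ k * ln (x $ k / u $ k))"
proof -
  have aW: "a \<in> W" using a by (simp add: maximizer_def)
  obtain b where b: "maximizer x b" using maximizer_exists by blast
  then have bW: "b \<in> W" by (simp add: maximizer_def)
  have eq: "value_fun x - value_fun u - vec_ln a \<bullet> (x - u) = x \<bullet> vec_ln b - x \<bullet> vec_ln a"
    by (simp add: value_fun_eq[OF a] value_fun_eq[OF b] inner_diff_right inner_commute)
  show "0 \<le> value_fun x - value_fun u - vec_ln a \<bullet> (x - u)"
    unfolding eq using b aW by (simp add: maximizer_def)
  show "value_fun x - value_fun u - vec_ln a \<bullet> (x - u)
      \<le> (\<Sum>k\<in>supp x. x $ k * ln (x $ k / u $ k))"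
    unfolding eq
    using inner_vec_ln_diff_le_KL[OF x u pos[OF aW] pos[OF bW]]
      maximizer_first_order[OF a rel_interior_prob_simplexD(1)[OF u] bW] by blast
qed

lemma scaled_value_fun_bounds:
  assumes "0 < L" and x: "x \<in> \<Delta>" and u: "u \<in> rel_interior \<Delta>" and a: "maximizer u a"
  shows "0 \<le> L * value_fun x - L * value_fun u - tangent_proj (L *\<^sub>R vec_ln a) \<bullet> (x - u)"
    and "L * value_fun x - L * value_fun u - tangent_proj (L *\<^sub>R vec_ln a) \<bullet> (x - u)
      \<le> L * (\<Sum>k\<in>supp x. x $ k * ln (x $ k / u $ k))"
proof -
  have "L * value_fun x - L * value_fun u - tangent_proj (L *\<^sub>R vec_ln a) \<bullet> (x - u)
      = L * (value_fun x - value_fun u - vec_ln a \<bullet> (x - u))"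
    using tangent_proj_inner_diff[OF x rel_interior_prob_simplexD(1)[OF u]]
    by (simp add: right_diff_distrib)
  with value_fun_bounds[OF x u a] \<open>0 < L\<close>
  show "0 \<le> L * value_fun x - L * value_fun u - tangent_proj (L *\<^sub>R vec_ln a) \<bullet> (x - u)"
    and "L * value_fun x - L * value_fun u - tangent_proj (L *\<^sub>R vec_ln a) \<bullet> (x - u)
      \<le> L * (\<Sum>k\<in>supp x. x $ k * ln (x $ k / u $ k))"
    by simp_all
qed

text \<open>
  Every maximizer at \<open>u\<close> yields the gradient, whichever one is chosen; this identifies the gradient at
  an interpolation node from the prescribed vector there.
\<close>

lemma has_tangent_gradient_value_fun:
  assumes L: "0 < L" and u: "u \<in> rel_interior \<Delta>" and a: "maximizer u a"
  shows "has_tangent_gradient (\<lambda>x. L * value_fun x) (tangent_proj (L *\<^sub>R vec_ln a)) u"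
proof (rule has_tangent_gradientI_quadratic[OF u tangent_proj_in])
  fix x :: "real ^ 'n" assume x: "x \<in> \<Delta>"
  have "L * (\<Sum>k\<in>supp x. x $ k * ln (x $ k / u $ k))
      \<le> (L * (\<Sum>k\<in>UNIV. 1 / u $ k)) * (norm (x - u))\<^sup>2"
    using KL_le_quadratic[OF x u] L by (simp add: mult.assoc)
  with scaled_value_fun_bounds[OF L x u a]
  show "\<bar>L * value_fun x - L * value_fun u - tangent_proj (L *\<^sub>R vec_ln a) \<bullet> (x - u)\<bar>
      \<le> (L * (\<Sum>k\<in>UNIV. 1 / u $ k)) * (norm (x - u))\<^sup>2" by linarith
qed

lemma convex_value_fun: "convex_on S value_fun"
  if "convex S" for S
proof (rule convex_onI)
  fix t :: real and x y :: "real ^ 'n" assume t: "0 < t" "t < 1"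
  obtain a where a: "maximizer ((1 - t) *\<^sub>R x + t *\<^sub>R y) a" using maximizer_exists by blast
  then have aW: "a \<in> W" by (simp add: maximizer_def)
  have "value_fun ((1 - t) *\<^sub>R x + t *\<^sub>R y) = (1 - t) * (x \<bullet> vec_ln a) + t * (y \<bullet> vec_ln a)"
    by (simp add: value_fun_eq[OF a] inner_add_left)
  also have "\<dots> \<le> (1 - t) * value_fun x + t * value_fun y"
    using t by (intro add_mono mult_left_mono value_fun_ge aW) auto
  finally show "value_fun ((1 - t) *\<^sub>R x + t *\<^sub>R y) \<le> (1 - t) * value_fun x + t * value_fun y" .
qed fact

lemma bounded_entries:
  obtains m M where "0 < m" "\<And>w k. w \<in> W \<Longrightarrow> m \<le> w $ k" "\<And>w k. w \<in> W \<Longrightarrow> w $ k \<le> M"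
proof -
  have "\<exists>w\<in>W. \<forall>w'\<in>W. w $ k \<le> w' $ k" for k
    by (intro continuous_attains_inf compact_W nonempty_W continuous_intros)
  then obtain lo where lo: "\<And>k. lo k \<in> W" "\<And>k w. w \<in> W \<Longrightarrow> lo k $ k \<le> w $ k" by metis
  obtain M where M: "\<And>w. w \<in> W \<Longrightarrow> norm w \<le> M"
    using compact_imp_bounded[OF compact_W] by (auto simp: bounded_iff)
  show ?thesis
  proof
    let ?m = "Min (range (\<lambda>k. lo k $ k))"
    show "0 < ?m" using pos[OF lo(1)] by (subst Min_gr_iff) auto
    show "?m \<le> w $ k" if "w \<in> W" for w k
      by (rule order_trans[OF Min_le lo(2)[OF that, of k]]) auto
    show "w $ k \<le> M" if "w \<in> W" for w k
      using component_le_norm_cart[of w k] M[OF that] by linarith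
  qed
qed

text \<open>
  Adding the conditions \<open>\<langle>u, b / a\<rangle> \<le> 1\<close> and \<open>\<langle>v, a / b\<rangle> \<le> 1\<close> gives
  \<open>\<Sum> u (b / a + a / b - 2) \<le> \<Sum> (u - v) a / b\<close>. The left-hand terms are the nonnegative numbers
  \<open>u (b - a)\<^sup>2 / (a b)\<close>, so each of them is controlled by the distance from \<open>u\<close> to \<open>v\<close>. The constant
  does not depend on \<open>v\<close>, which suffices for continuity at \<open>u\<close>.
\<close>

lemma maximizer_stability:
  assumes u: "u \<in> rel_interior \<Delta>" and v: "v \<in> rel_interior \<Delta>"
    and a: "maximizer u a" and b: "maximizer v b"
    and m: "0 < m" "\<And>w k. w \<in> W \<Longrightarrow> m \<le> w $ k" and M: "\<And>w k. w \<in> W \<Longrightarrow> w $ k \<le> M"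
  shows "(b $ k - a $ k)\<^sup>2 \<le> M\<^sup>2 / u $ k * (M / m) * (\<Sum>j\<in>UNIV. \<bar>u $ j - v $ j\<bar>)"
proof -
  have aW: "a \<in> W" and bW: "b \<in> W" using a b by (auto simp: maximizer_def)
  note a0 = pos[OF aW] and b0 = pos[OF bW] and u0 = rel_interior_prob_simplexD(2)[OF u]
  have M0: "0 < M" using a0[of k] M[OF aW, of k] by linarith
  have us: "(\<Sum>j\<in>UNIV. u $ j) = 1" and vs: "(\<Sum>j\<in>UNIV. v $ j) = 1"
    using u v by (auto simp: rel_interior_prob_simplex)
  have 1: "(\<Sum>j\<in>UNIV. u $ j * (b $ j / a $ j)) \<le> 1"
    using maximizer_first_order[OF a rel_interior_prob_simplexD(1)[OF u] bW]
    by (simp add: inner_vec_def vec_div_def)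
  have 2: "(\<Sum>j\<in>UNIV. v $ j * (a $ j / b $ j)) \<le> 1"
    using maximizer_first_order[OF b rel_interior_prob_simplexD(1)[OF v] aW]
    by (simp add: inner_vec_def vec_div_def)
  have sq: "(b $ j - a $ j)\<^sup>2 / (a $ j * b $ j) = b $ j / a $ j + a $ j / b $ j - 2" for j
    using a0[of j] b0[of j] by (simp add: field_simps power2_eq_square)
  have "u $ k * ((b $ k - a $ k)\<^sup>2 / (a $ k * b $ k))
      \<le> (\<Sum>j\<in>UNIV. u $ j * ((b $ j - a $ j)\<^sup>2 / (a $ j * b $ j)))"
    using u0 a0 b0
    by (intro member_le_sum) (auto intro!: mult_nonneg_nonneg divide_nonneg_pos simp: less_imp_le)
  also have "\<dots> = (\<Sum>j\<in>UNIV. u $ j * (b $ j / a $ j)) + (\<Sum>j\<in>UNIV. u $ j * (a $ j / b $ j)) - 2"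
    using us by (simp add: sq algebra_simps sum.distrib sum_subtractf flip: sum_distrib_left sum_distrib_right)
  also have "\<dots> \<le> (\<Sum>j\<in>UNIV. u $ j * (a $ j / b $ j)) - (\<Sum>j\<in>UNIV. v $ j * (a $ j / b $ j))"
    using 1 2 by linarith
  also have "\<dots> = (\<Sum>j\<in>UNIV. (u $ j - v $ j) * (a $ j / b $ j))"
    by (simp only: left_diff_distrib sum_subtractf)
  also have "\<dots> \<le> (\<Sum>j\<in>UNIV. \<bar>u $ j - v $ j\<bar> * (M / m))"
  proof (rule sum_mono)
    fix j
    have "(u $ j - v $ j) * (a $ j / b $ j) \<le> \<bar>u $ j - v $ j\<bar> * (a $ j / b $ j)"
      using a0[of j] b0[of j] by (intro mult_right_mono) auto
    also have "\<dots> \<le> \<bar>u $ j - v $ j\<bar> * (M / m)"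
      using a0[of j] M[OF aW, of j] m(1) m(2)[OF bW, of j]
      by (intro mult_left_mono frac_le) auto
    finally show "(u $ j - v $ j) * (a $ j / b $ j) \<le> \<bar>u $ j - v $ j\<bar> * (M / m)" .
  qed
  finally have main: "u $ k * ((b $ k - a $ k)\<^sup>2 / (a $ k * b $ k))
      \<le> (M / m) * (\<Sum>j\<in>UNIV. \<bar>u $ j - v $ j\<bar>)" (is "_ \<le> ?R")
    by (simp add: sum_distrib_left mult.commute)
  have "(b $ k - a $ k)\<^sup>2
      = (a $ k * b $ k / u $ k) * (u $ k * ((b $ k - a $ k)\<^sup>2 / (a $ k * b $ k)))"
    using u0[of k] a0[of k] b0[of k] by simp
  also have "\<dots> \<le> (a $ k * b $ k / u $ k) * ?R"
    using u0[of k] a0[of k] b0[of k] main by (intro mult_left_mono) auto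
  also have "\<dots> \<le> (M\<^sup>2 / u $ k) * ?R"
  proof (rule mult_right_mono)
    have "a $ k * b $ k \<le> M * M"
      using M[OF aW, of k] M[OF bW, of k] b0[of k] M0 by (intro mult_mono) auto
    then show "a $ k * b $ k / u $ k \<le> M\<^sup>2 / u $ k"
      using u0[of k] by (simp add: divide_right_mono power2_eq_square less_imp_le)
    show "0 \<le> ?R" using M0 m(1) by (intro mult_nonneg_nonneg sum_nonneg) auto
  qed
  finally show ?thesis by (simp add: mult.assoc)
qed

lemma maximizer_selection_continuous:
  assumes a: "\<And>u. u \<in> rel_interior \<Delta> \<Longrightarrow> maximizer u (a u)"
  shows "continuous_on (rel_interior \<Delta>) a"
  unfolding continuous_on_def
proof (intro ballI vec_tendstoI)
  fix u :: "real ^ 'n" and k assume u: "u \<in> rel_interior \<Delta>"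
  obtain m M where mM: "0 < m" "\<And>w k. w \<in> W \<Longrightarrow> m \<le> w $ k" "\<And>w k. w \<in> W \<Longrightarrow> w $ k \<le> M"
    using bounded_entries by blast
  let ?F = "at u within rel_interior \<Delta>"
  let ?R = "\<lambda>v. M\<^sup>2 / u $ k * (M / m) * (\<Sum>j\<in>UNIV. \<bar>u $ j - v $ j\<bar>)"
  have "(?R \<longlongrightarrow> M\<^sup>2 / u $ k * (M / m) * (\<Sum>j\<in>UNIV. \<bar>u $ j - u $ j\<bar>)) ?F"
    by (intro tendsto_intros)
  then have R: "(?R \<longlongrightarrow> 0) ?F" by simp
  have "((\<lambda>v. (a v $ k - a u $ k)\<^sup>2) \<longlongrightarrow> 0) ?F"
  proof (rule tendsto_sandwich[OF _ _ tendsto_const R])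
    show "\<forall>\<^sub>F v in ?F. (a v $ k - a u $ k)\<^sup>2 \<le> ?R v"
      unfolding eventually_at_filter
      using maximizer_stability[OF u _ a[OF u] a mM] by (auto intro!: always_eventually)
  qed simp
  then have "((\<lambda>v. a v $ k - a u $ k) \<longlongrightarrow> 0) ?F"
    by simp
  then show "((\<lambda>v. a v $ k) \<longlongrightarrow> a u $ k) ?F" by (simp add: LIM_zero_iff)
qed

theorem scaled_value_fun_Ent:
  assumes L: "0 < L"
  shows "(\<lambda>x. L * value_fun x) \<in> Ent L"
proof -
  let ?f = "\<lambda>x. L * value_fun x"
  have cv: "convex (\<Delta> :: (real ^ 'n) set)"
    unfolding convex_def prob_simplex_def
    by (auto simp: sum.distrib simp flip: sum_distrib_left)
  define a where "a u = (SOME a. maximizer u a)" for u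
  have a: "maximizer u (a u)" for u
    unfolding a_def using maximizer_exists by (rule someI_ex)
  have grad: "\<nabla> ?f u = tangent_proj (L *\<^sub>R vec_ln (a u))" if "u \<in> rel_interior \<Delta>" for u
    using tangent_gradient_eqI[OF that has_tangent_gradient_value_fun[OF L that a]] .
  have "continuous_on (rel_interior \<Delta>) (\<lambda>u. tangent_proj (L *\<^sub>R vec_ln (a u)))"
    unfolding tangent_proj_def vec_ln_def
    using maximizer_selection_continuous[OF a] pos a
    by (auto intro!: continuous_intros simp: maximizer_def less_imp_neq[THEN not_sym])
  then have "continuous_on (rel_interior \<Delta>) (\<nabla> ?f)"
    by (simp add: grad cong: continuous_on_cong)
  moreover have "convex_on \<Delta> ?f"
    using convex_on_cmul[of L \<Delta> value_fun] convex_value_fun[OF cv] L by simp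
  moreover have "?f differentiable (at u within affine hull \<Delta>)" if "u \<in> rel_interior \<Delta>" for u
    using has_tangent_gradient_value_fun[OF L that a]
    by (auto simp: has_tangent_gradient_def differentiable_def)
  moreover have "0 \<le> ?f x - ?f u - \<nabla> ?f u \<bullet> (x - u)"
      "ereal (?f x - ?f u - \<nabla> ?f u \<bullet> (x - u)) \<le> ereal L * KL x u"
    if "x \<in> \<Delta>" "u \<in> rel_interior \<Delta>" for x u
    using scaled_value_fun_bounds[OF L that a] that by (simp_all add: grad KL_rel_interior)
  ultimately show ?thesis by (simp add: Ent_def)
qed

end

section \<open>Comparison of two tangents\<close>

text \<open>
  By the Gibbs variational principle the maximum of \<open>\<langle>z, ln q\<rangle>\<close> minus the divergence of \<open>z\<close> from \<open>u\<close>
  over the simplex is \<open>ln \<langle>u, q\<rangle>\<close>, attained at the tilted distribution \<open>z = u q / \<langle>u, q\<rangle>\<close>. With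
  \<open>q = b / a\<close>, the quantity \<open>L \<langle>z, ln q\<rangle>\<close> is the difference at \<open>z\<close> of the tangents of \<open>f\<close> at \<open>v\<close> and at
  \<open>u\<close>, which the two bounds of the class keep below \<open>L\<close> times the divergence.
\<close>

lemma Ent_imp_inner_vec_div_le_one:
  fixes f :: "real ^ 'n \<Rightarrow> real" and u v a b :: "real ^ 'n"
  assumes L: "0 < L" and f: "f \<in> Ent L"
    and u: "u \<in> rel_interior \<Delta>" and v: "v \<in> rel_interior \<Delta>"
    and a: "a = vec_exp ((1 / L) *\<^sub>R ((f u - \<nabla> f u \<bullet> u) *\<^sub>R 1 + \<nabla> f u))"
    and b: "b = vec_exp ((1 / L) *\<^sub>R ((f v - \<nabla> f v \<bullet> v) *\<^sub>R 1 + \<nabla> f v))"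
  shows "u \<bullet> vec_div b a \<le> 1"
proof -
  define q where "q = vec_div b a"
  define Z where "Z = u \<bullet> q"
  define z :: "real ^ 'n" where "z = (\<chi> k. u $ k * q $ k / Z)"
  note u0 = rel_interior_prob_simplexD(2)[OF u]
  have q0: "0 < q $ k" for k by (simp add: q_def a b vec_div_def vec_exp_def)
  have Z: "Z = (\<Sum>k\<in>UNIV. u $ k * q $ k)" by (simp add: Z_def inner_vec_def)
  then have Z0: "0 < Z" using u0 q0 by (auto intro!: sum_pos mult_pos_pos)
  have z0: "0 < z $ k" for k using u0[of k] q0[of k] Z0 by (simp add: z_def)
  have zs: "(\<Sum>k\<in>UNIV. z $ k) = 1"
    using Z0 by (simp add: z_def Z flip: sum_divide_distrib)
  have zD: "z \<in> rel_interior \<Delta>" using z0 zs by (simp add: rel_interior_prob_simplex)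
  note z1 = rel_interior_prob_simplexD(1)[OF zD]
  have lnq: "L * ln (q $ k) = (f v - \<nabla> f v \<bullet> v + \<nabla> f v $ k) - (f u - \<nabla> f u \<bullet> u + \<nabla> f u $ k)" for k
    using L by (simp add: q_def a b vec_div_def vec_exp_def ln_div field_simps)
  have "(\<Sum>k\<in>UNIV. z $ k * (L * ln (q $ k)))
      = (f v - \<nabla> f v \<bullet> v) - (f u - \<nabla> f u \<bullet> u) + \<nabla> f v \<bullet> z - \<nabla> f u \<bullet> z"
    unfolding lnq
    by (simp add: inner_vec_def[of _ z] right_diff_distrib distrib_left sum_subtractf sum.distrib zs
        mult.commute[of "z $ _"] flip: sum_distrib_left)
  also have "\<dots> = (f v + \<nabla> f v \<bullet> (z - v)) - (f u + \<nabla> f u \<bullet> (z - u))"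
    by (simp add: inner_diff_right)
  also have "\<dots> \<le> f z - (f u + \<nabla> f u \<bullet> (z - u))"
    using f z1 v by (auto simp: Ent_def algebra_simps)
  also have "\<dots> \<le> L * (\<Sum>k\<in>UNIV. z $ k * ln (z $ k / u $ k))"
  proof -
    have "ereal (f z - f u - \<nabla> f u \<bullet> (z - u)) \<le> ereal L * KL z u"
      using f z1 u by (auto simp: Ent_def)
    then show ?thesis by (simp add: KL_rel_interior[OF u] sum_supp algebra_simps)
  qed
  also have "\<dots> = (\<Sum>k\<in>UNIV. z $ k * (L * ln (q $ k))) - L * ln Z"
  proof -
    have "z $ k * ln (z $ k / u $ k) = z $ k * ln (q $ k) - z $ k * ln Z" for k
    proof -
      have "z $ k / u $ k = q $ k / Z" using u0[of k] by (simp add: z_def)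
      then show ?thesis using q0[of k] Z0 by (simp add: ln_div right_diff_distrib)
    qed
    then have "(\<Sum>k\<in>UNIV. z $ k * ln (z $ k / u $ k)) = (\<Sum>k\<in>UNIV. z $ k * ln (q $ k)) - ln Z"
      by (simp add: sum_subtractf zs flip: sum_distrib_right)
    then show ?thesis
      by (simp add: right_diff_distrib sum_distrib_left mult.left_commute[of L])
  qed
  finally have "ln Z \<le> 0" using L by (simp add: mult_le_0_iff)
  then show ?thesis using Z0 by (simp add: Z_def q_def)
qed

section \<open>Interpolation\<close>

theorem lemma12:
  fixes L :: real and N :: nat
    and x \<xi> :: "nat \<Rightarrow> real ^ 'n" and \<phi> r :: "nat \<Rightarrow> real" and w :: "nat \<Rightarrow> real ^ 'n"
  assumes "L > 0"
    and "\<And>i. i \<in> {1..N} \<Longrightarrow> x i \<in> rel_interior \<Delta>"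
    and "\<And>i. i \<in> {1..N} \<Longrightarrow> \<xi> i \<in> \<Theta>"
    and "\<And>i. i \<in> {1..N} \<Longrightarrow> r i = \<phi> i - \<xi> i \<bullet> x i"
    and "\<And>i. i \<in> {1..N} \<Longrightarrow> w i = vec_exp ((1 / L) *\<^sub>R (r i *\<^sub>R 1 + \<xi> i))"
  shows "(\<exists>f \<in> Ent L. \<forall>i\<in>{1..N}. f (x i) = \<phi> i \<and> \<nabla> f (x i) = \<xi> i)
     \<longleftrightarrow> (\<forall>i\<in>{1..N}. \<forall>j\<in>{1..N}. x i \<bullet> vec_div (w j) (w i) \<le> 1)"
proof
  assume "\<exists>f \<in> Ent L. \<forall>i\<in>{1..N}. f (x i) = \<phi> i \<and> \<nabla> f (x i) = \<xi> i"
  then obtain f where f: "f \<in> Ent L" "\<And>i. i \<in> {1..N} \<Longrightarrow> f (x i) = \<phi> i"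
    "\<And>i. i \<in> {1..N} \<Longrightarrow> \<nabla> f (x i) = \<xi> i" by blast
  show "\<forall>i\<in>{1..N}. \<forall>j\<in>{1..N}. x i \<bullet> vec_div (w j) (w i) \<le> 1"
  proof (intro ballI)
    fix i j assume ij: "i \<in> {1..N}" "j \<in> {1..N}"
    show "x i \<bullet> vec_div (w j) (w i) \<le> 1"
      by (rule Ent_imp_inner_vec_div_le_one[OF assms(1) f(1) assms(2)[OF ij(1)] assms(2)[OF ij(2)]])
        (use ij in \<open>simp_all only: assms(4,5) f(2,3)\<close>)
  qed
next
  assume opt: "\<forall>i\<in>{1..N}. \<forall>j\<in>{1..N}. x i \<bullet> vec_div (w j) (w i) \<le> 1"
  \<comment> \<open>For \<open>N = 0\<close> any nonempty compact convex set of positive vectors serves; the vector \<open>1\<close> gives the zero function.\<close>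
  define W where "W = convex hull (if N = 0 then {1} else w ` {1..N})"
  have pos: "0 < y $ k" if "y \<in> W" for y k
  proof -
    have "convex {y :: real ^ 'n. 0 < y $ k}"
      using convex_halfspace_gt[of 0 "axis k 1 :: real ^ 'n"] by (simp add: inner_axis')
    then have "W \<subseteq> {y. 0 < y $ k}"
      unfolding W_def by (intro hull_minimal) (auto simp: assms(5) vec_exp_def)
    with that show ?thesis by blast
  qed
  interpret positive_convex_body W
    by unfold_locales
      (auto simp: pos W_def intro!: finite_imp_compact_convex_hull)
  have "L * value_fun (x i) = \<phi> i \<and> \<nabla> (\<lambda>x. L * value_fun x) (x i) = \<xi> i" if i: "i \<in> {1..N}" for i
  proof -
    have wW: "w i \<in> W" using i by (auto simp: W_def intro!: hull_inc)
    \<comment> \<open>The first-order condition defines a half-space, so it passes from the \<open>w j\<close> to their hull.\<close>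
    have "W \<subseteq> {y. (\<chi> k. x i $ k / w i $ k) \<bullet> y \<le> 1}"
      unfolding W_def using i opt
      by (intro hull_minimal convex_halfspace_le) (auto simp: inner_vec_def vec_div_def)
    then have "maximizer (x i) (w i)"
      by (intro maximizerI assms(2) i wW) (auto simp: inner_vec_def vec_div_def)
    moreover have ln: "L *\<^sub>R vec_ln (w i) = r i *\<^sub>R 1 + \<xi> i"
      using assms(1) by (simp add: assms(5)[OF i] vec_ln_def vec_exp_def vec_eq_iff)
    moreover have "L * (x i \<bullet> vec_ln (w i)) = \<phi> i"
      unfolding inner_scaleR_right[symmetric] ln using one_inner_prob_simplex[OF rel_interior_prob_simplexD(1)[OF assms(2)[OF i]]]
      by (simp add: assms(4)[OF i] inner_add_right inner_commute)
    moreover note has_tangent_gradient_value_fun[OF assms(1) assms(2)[OF i], of "w i"]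
    ultimately show ?thesis
      using tangent_gradient_eqI[OF assms(2)[OF i]] tangent_proj_add_one[OF assms(3)[OF i]]
      by (simp add: value_fun_eq)
  qed
  then show "\<exists>f \<in> Ent L. \<forall>i\<in>{1..N}. f (x i) = \<phi> i \<and> \<nabla> f (x i) = \<xi> i"
    using scaled_value_fun_Ent[OF assms(1)] by (intro bexI) auto
qed

end
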